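(* Let $a,b,p,q$ be real numbers and let $(\mathbb{H}\mathcal{J}_n)_{n\ge 0}$ be the sequence of generalized hybrid Fibonacci numbers with parameters $a,b,p,q$. Then, as formal power series in $t$ with coefficients in the hybrid numbers $\mathbb{K}$ ($t$ commuting with the coefficients), $$\sum_{r=0}^{\infty}\mathbb{H}\mathcal{J}_{r}t^{r}=\frac{a+b\mathbf{i}+(pb+qa)\boldsymbol{\varepsilon}+((p^{2}+q)b+pqa)\mathbf{h}+t\left((b-pa)+qa\,\mathbf{i}+qb\,\boldsymbol{\varepsilon}+(pqb+q^{2}a)\mathbf{h}\right)}{1-pt-qt^2}.$$
   Context: The hybrid numbers $\mathbb{K}$ are the 4-dimensional associative unital real algebra with basis $1,\mathbf{i},\boldsymbol{\varepsilon},\mathbf{h}$ and multiplication $\mathbf{i}^2=-1$, $\boldsymbol{\varepsilon}^2=0$, $\mathbf{h}^2=1$, $\mathbf{i}\boldsymbol{\varepsilon}=1-\mathbf{h}$, $\boldsymbol{\varepsilon}\mathbf{i}=1+\mathbf{h}$, $\mathbf{i}\mathbf{h}=\boldsymbol{\varepsilon}+\mathbf{i}$, $\mathbf{h}\mathbf{i}=-(\boldsymbol{\varepsilon}+\mathbf{i})$, $\boldsymbol{\varepsilon}\mathbf{h}=-\boldsymbol{\varepsilon}$, $\mathbf{h}\boldsymbol{\varepsilon}=\boldsymbol{\varepsilon}$. The generalized hybrid Fibonacci numbers with real parameters $a,b,p,q$ are defined by $\mathbb{H}\mathcal{J}_{n}=p\mathbb{H}\mathcal{J}_{n-1}+q\mathbb{H}\mathcal{J}_{n-2}$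 for $n\ge 2$, with $\mathbb{H}\mathcal{J}_{0}=a+b\mathbf{i}+(pb+qa)\boldsymbol{\varepsilon}+((p^{2}+q)b+pqa)\mathbf{h}$ and $\mathbb{H}\mathcal{J}_{1}=b+(pb+qa)\mathbf{i}+((p^{2}+q)b+pqa)\boldsymbol{\varepsilon}+((p^{3}+2pq)b+q(p^{2}+q)a)\mathbf{h}$. *)

theory Defs
  imports Complex_Main "HOL-Computational_Algebra.Formal_Power_Series"
begin

text \<open>\<open>Hybrid x y z w\<close> stands for \<open>x + y i + z \<epsilon> + w h\<close>; see \<open>Hybrid_eq_basis\<close> below.\<close>

codatatype hybrid = Hybrid (Hre: real) (Him: real) (Heps: real) (Hhyp: real)

lemma hybrid_eq_iff:
  "x = y \<longleftrightarrow> Hre x = Hre y \<and> Him x = Him y \<and> Heps x = Heps y \<and> Hhyp x = Hhyp y"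
  by (auto intro: hybrid.expand)

instantiation hybrid :: real_algebra_1
begin

primcorec zero_hybrid where
  "Hre 0 = 0" | "Him 0 = 0" | "Heps 0 = 0" | "Hhyp 0 = 0"

primcorec one_hybrid where
  "Hre 1 = 1" | "Him 1 = 0" | "Heps 1 = 0" | "Hhyp 1 = 0"

primcorec plus_hybrid where
  "Hre (x + y) = Hre x + Hre y"
| "Him (x + y) = Him x + Him y"
| "Heps (x + y) = Heps x + Heps y"
| "Hhyp (x + y) = Hhyp x + Hhyp y"

primcorec uminus_hybrid where
  "Hre (- x) = - Hre x"
| "Him (- x) = - Him x"
| "Heps (- x) = - Heps x"
| "Hhyp (- x) = - Hhyp x"

primcorec minus_hybrid where
  "Hre (x - y) = Hre x - Hre y"
| "Him (x - y) = Him x - Him y"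
| "Heps (x - y) = Heps x - Heps y"
| "Hhyp (x - y) = Hhyp x - Hhyp y"

primcorec scaleR_hybrid where
  "Hre (scaleR r x) = r * Hre x"
| "Him (scaleR r x) = r * Him x"
| "Heps (scaleR r x) = r * Heps x"
| "Hhyp (scaleR r x) = r * Hhyp x"

text \<open>The bilinear extension of the multiplication table of the basis, which is
  recovered in \<open>hybrid_mult_table\<close>.\<close>

primcorec times_hybrid where
  "Hre (x * y) = Hre x * Hre y - Him x * Him y + Him x * Heps y + Heps x * Him y + Hhyp x * Hhyp y"
| "Him (x * y) = Hre x * Him y + Him x * Hre y + Him x * Hhyp y - Hhyp x * Him y"
| "Heps (x * y) = Hre x * Heps y + Heps x * Hre y + Him x * Hhyp y - Hhyp x * Him y
     - Heps x * Hhyp y + Hhyp x * Heps y"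
| "Hhyp (x * y) = Hre x * Hhyp y + Hhyp x * Hre y - Him x * Heps y + Heps x * Him y"

instance
  by standard (simp_all add: hybrid_eq_iff algebra_simps)

end

definition hyb_i :: hybrid where "hyb_i = Hybrid 0 1 0 0"
definition hyb_eps :: hybrid where "hyb_eps = Hybrid 0 0 1 0"
definition hyb_h :: hybrid where "hyb_h = Hybrid 0 0 0 1"

lemma Hybrid_eq_basis:
  "Hybrid x y z w = of_real x + y *\<^sub>R hyb_i + z *\<^sub>R hyb_eps + w *\<^sub>R hyb_h"
  by (simp add: hybrid_eq_iff of_real_def hyb_i_def hyb_eps_def hyb_h_def)

lemma hybrid_mult_table:
  "hyb_i * hyb_i = - 1" "hyb_eps * hyb_eps = 0" "hyb_h * hyb_h = 1"
  "hyb_i * hyb_eps = 1 - hyb_h" "hyb_eps * hyb_i = 1 + hyb_h"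
  "hyb_i * hyb_h = hyb_eps + hyb_i" "hyb_h * hyb_i = - (hyb_eps + hyb_i)"
  "hyb_eps * hyb_h = - hyb_eps" "hyb_h * hyb_eps = hyb_eps"
  by (simp_all add: hybrid_eq_iff hyb_i_def hyb_eps_def hyb_h_def)

text \<open>
  The library defines division of formal power series over any coefficient type with an
  \<open>inverse\<close> operation. Hybrid numbers have zero divisors, so \<open>inverse\<close> is the two-sided
  inverse \<open>conj x / (x * conj x)\<close> where it exists and \<open>0\<close> elsewhere; here
  \<open>conj x = Hre x - Him x i - Heps x \<epsilon> - Hhyp x h\<close> and \<open>x * conj x\<close> is real.
\<close>

instantiation hybrid :: inverse
begin

definition inverse_hybrid :: "hybrid \<Rightarrow> hybrid" where
  "inverse x =
     inverse ((Hre x)\<^sup>2 + (Him x)\<^sup>2 - 2 * Him x * Heps x - (Hhyp x)\<^sup>2) *\<^sub>R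
       Hybrid (Hre x) (- Him x) (- Heps x) (- Hhyp x)"

definition divide_hybrid :: "hybrid \<Rightarrow> hybrid \<Rightarrow> hybrid" where
  "divide_hybrid x y = x * inverse y"

instance ..

end

lemma hybrid_inverse:
  fixes x :: hybrid
  assumes "(Hre x)\<^sup>2 + (Him x)\<^sup>2 - 2 * Him x * Heps x - (Hhyp x)\<^sup>2 \<noteq> 0"
  shows "x * inverse x = 1" "inverse x * x = 1"
proof -
  define k where "k = (Hre x)\<^sup>2 + (Him x)\<^sup>2 - 2 * Him x * Heps x - (Hhyp x)\<^sup>2"
  define c where "c = Hybrid (Hre x) (- Him x) (- Heps x) (- Hhyp x)"
  have "x * c = k *\<^sub>R 1" "c * x = k *\<^sub>R 1"
    by (simp_all add: c_def k_def hybrid_eq_iff power2_eq_square)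
  moreover have "inverse x = inverse k *\<^sub>R c"
    by (simp add: inverse_hybrid_def k_def c_def)
  ultimately show "x * inverse x = 1" "inverse x * x = 1"
    using assms by (simp_all add: k_def)
qed

lemma inverse_hybrid_one: "inverse (1 :: hybrid) = 1"
  by (simp add: inverse_hybrid_def hybrid_eq_iff)

text \<open>For a denominator with constant term \<open>1\<close> the library division of hybrid power series is
  the genuine quotient: the unique series whose product with the denominator is the numerator.\<close>

lemma hybrid_fps_divide_iff:
  fixes f g n :: "hybrid fps"
  assumes "fps_nth g 0 = 1"
  shows "n / g = f \<longleftrightarrow> f * g = n"
proof -
  have sd: "subdegree g = 0"
    using assms by (intro subdegree_eq_0) simp
  have div: "n / g = n * inverse g"
    by (simp add: fps_divide_unit' sd)
  have r: "g * inverse g = 1"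
    unfolding fps_inverse_def
    by (rule fps_right_inverse) (simp add: assms inverse_hybrid_one)
  have l: "inverse g * g = 1"
    unfolding fps_inverse_def
    by (rule fps_left_inverse'[where x = 1]) (simp_all add: assms inverse_hybrid_one)
  show ?thesis
    unfolding div using l r by (metis mult.assoc mult.right_neutral)
qed

fun gen_hybrid_fib :: "real \<Rightarrow> real \<Rightarrow> real \<Rightarrow> real \<Rightarrow> nat \<Rightarrow> hybrid" where
  "gen_hybrid_fib a b p q 0 =
     Hybrid a b (p * b + q * a) ((p\<^sup>2 + q) * b + p * q * a)"
| "gen_hybrid_fib a b p q (Suc 0) =
     Hybrid b (p * b + q * a) ((p\<^sup>2 + q) * b + p * q * a)
       ((p ^ 3 + 2 * p * q) * b + q * (p\<^sup>2 + q) * a)"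
| "gen_hybrid_fib a b p q (Suc (Suc n)) =
     p *\<^sub>R gen_hybrid_fib a b p q (Suc n) + q *\<^sub>R gen_hybrid_fib a b p q n"

end

theory Submission
  imports Defs
begin

text \<open>The denominator has constant term 1, so by \<open>hybrid_fps_divide_iff\<close> the
  quotient formula amounts to a product identity, checked coefficientwise with
  \<open>fps_mult_quadratic_nth\<close>. The recurrence kills every coefficient from degree 2 on;
  the initial values give the other two.\<close>

lemma fps_mult_quadratic_nth:
  fixes f :: "'a :: ring_1 fps"
  shows "fps_nth (f * (1 - fps_const c * fps_X - fps_const d * fps_X\<^sup>2)) n =
    fps_nth f n - (if n = 0 then 0 else fps_nth f (n - 1) * c)
      - (if n < 2 then 0 else fps_nth f (n - 2) * d)"
  by (simp add: right_diff_distrib fps_X_power_mult_right_nth flip: mult.assoc)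

theorem theorem2p1:
  fixes a b p q :: real
  shows "Abs_fps (gen_hybrid_fib a b p q) =
    (fps_const (Hybrid a b (p * b + q * a) ((p\<^sup>2 + q) * b + p * q * a)) +
     fps_X * fps_const (Hybrid (b - p * a) (q * a) (q * b) (p * q * b + q\<^sup>2 * a))) /
    (1 - fps_const (of_real p) * fps_X - fps_const (of_real q) * fps_X\<^sup>2)"
    (is "?f = ?n / ?g")
proof -
  have "fps_nth ?g 0 = 1"
    by simp
  moreover have "?f * ?g = ?n"
  proof (rule fps_ext)
    fix k
    consider "k = 0" | "k = 1" | m where "k = Suc (Suc m)"
      by (metis One_nat_def not0_implies_Suc)
    then show "fps_nth (?f * ?g) k = fps_nth ?n k"
    proof cases
      case 1
      then show ?thesis
        by (simp add: fps_mult_quadratic_nth)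
    next
      \<comment> \<open>The numerator's linear coefficient is the second initial value minus
        \<open>p\<close> times the first.\<close>
      case 2
      then show ?thesis
        by (simp add: fps_mult_quadratic_nth of_real_def hybrid_eq_iff
            algebra_simps power2_eq_square power3_eq_cube)
    next
      \<comment> \<open>The numerator has degree at most 1, so this is the recurrence;
        \<open>of_real_def\<close> turns right multiplication by \<open>of_real p\<close> into
        scaling.\<close>
      case 3
      then show ?thesis
        by (simp add: fps_mult_quadratic_nth of_real_def)
    qed
  qed
  ultimately show ?thesis
    by (metis hybrid_fps_divide_iff)
qed

end
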